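(* Let $f$ be a non-constant meromorphic function on the unit disk $\mathbb{D}$ and let $k\in\mathbb{N}=\{1,2,3,\dots\}$. Then the generalized Schwarzian derivative $S_k(f)$ of order $k$ satisfies $$S_k(f)=\sum_{(n_1,\dots,n_k)\in\Lambda}\left(\frac{-k\cdot k!}{\prod_{j=1}^k\big[(-k\cdot j!)^{n_j}\cdot n_j!\big]}\cdot\prod_{j=1}^k\left(\Big(\frac{f''}{f'}\Big)^{(j-1)}\right)^{n_j}\right),$$ where $\Lambda$ is the set of all tuples $(n_1,\dots,n_k)$ of non-negative integers with $\sum_{r=1}^k r\,n_r=k$.
   Context: $\mathbb{D}=\{z\in\mathbb{C}:|z|<1\}$. For a non-constant meromorphic function $f$ on $\mathbb{D}$ and $n\in\mathbb{N}$, put $S_{2,n}(f):=f''/f'$ and, for $k\ge 2$, $S_{k+1,n}(f):=\big(S_{k,n}(f)\big)'-\frac1n\frac{f''}{f'}\,S_{k,n}(f)$ (as meromorphic functions on $\mathbb{D}$). For $k\in\mathbb{N}$ the generalized Schwarzian derivative of order $k$ is $S_k(f):=S_{k+1,k}(f)$. The superscript $(j-1)$ denotes the $(j-1)$-th derivative, and a zeroth power is $1$. *)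

theory Defs
  imports "HOL-Complex_Analysis.Complex_Analysis"
begin

text \<open>
  A meromorphic function is represented by a function satisfying \<open>meromorphic_on\<close>, whose values
  at the points of a sparse set (in particular at poles) carry no information. Two such functions
  are equal as meromorphic functions on \<open>A\<close> iff they agree on \<open>A\<close> off a sparse set; likewise
  \<open>deriv\<close> is the meromorphic derivative off a sparse set.
\<close>

definition mero_eq_on :: "complex set \<Rightarrow> (complex \<Rightarrow> complex) \<Rightarrow> (complex \<Rightarrow> complex) \<Rightarrow> bool"
  where "mero_eq_on A g h \<longleftrightarrow> (\<forall>\<^sub>\<approx>z\<in>A. g z = h z)"

definition mero_constant_on :: "(complex \<Rightarrow> complex) \<Rightarrow> complex set \<Rightarrow> bool"
  where "mero_constant_on f A \<longleftrightarrow> (\<exists>c. mero_eq_on A f (\<lambda>_. c))"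

definition pre_schwarzian :: "(complex \<Rightarrow> complex) \<Rightarrow> complex \<Rightarrow> complex"
  where "pre_schwarzian f = (\<lambda>z. deriv (deriv f) z / deriv f z)"

text \<open>
  \<open>schwarzian_aux k n f\<close> is $S_{k,n}(f)$, which is only meaningful for \<open>k \<ge> 2\<close>;
  the first two equations are dummy values.
\<close>

fun schwarzian_aux :: "nat \<Rightarrow> nat \<Rightarrow> (complex \<Rightarrow> complex) \<Rightarrow> complex \<Rightarrow> complex" where
  "schwarzian_aux 0 n f = (\<lambda>_. 0)"
| "schwarzian_aux (Suc 0) n f = (\<lambda>_. 0)"
| "schwarzian_aux (Suc (Suc 0)) n f = pre_schwarzian f"
| "schwarzian_aux (Suc (Suc (Suc k))) n f =
     (\<lambda>z. deriv (schwarzian_aux (Suc (Suc k)) n f) z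
          - 1 / of_nat n * pre_schwarzian f z * schwarzian_aux (Suc (Suc k)) n f z)"

definition gen_schwarzian :: "nat \<Rightarrow> (complex \<Rightarrow> complex) \<Rightarrow> complex \<Rightarrow> complex"
  where "gen_schwarzian k f = schwarzian_aux (k + 1) k f"

definition weighted_tuples :: "nat \<Rightarrow> (nat \<Rightarrow> nat) set"
  where "weighted_tuples k = {n \<in> {1..k} \<rightarrow>\<^sub>E UNIV. (\<Sum>r=1..k. r * n r) = k}"

lemma finite_weighted_tuples: "finite (weighted_tuples k)"
proof (rule finite_subset)
  show "weighted_tuples k \<subseteq> {1..k} \<rightarrow>\<^sub>E {..k}"
  proof
    fix n assume n: "n \<in> weighted_tuples k"
    have "n j \<le> k" if j: "j \<in> {1..k}" for j
    proof -
      have "n j \<le> j * n j" using j by simp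
      also have "\<dots> \<le> (\<Sum>r=1..k. r * n r)" using j by (intro member_le_sum) auto
      finally show ?thesis using n by (simp add: weighted_tuples_def)
    qed
    thus "n \<in> {1..k} \<rightarrow>\<^sub>E {..k}" using n by (auto simp: weighted_tuples_def PiE_iff)
  qed
qed (auto intro: finite_PiE)

lemma meromorphic_on_pre_schwarzian:
  "f meromorphic_on A \<Longrightarrow> pre_schwarzian f meromorphic_on A"
  unfolding pre_schwarzian_def by (intro meromorphic_intros)

lemma meromorphic_on_schwarzian_aux:
  "f meromorphic_on A \<Longrightarrow> schwarzian_aux k n f meromorphic_on A"
  by (induction k n f rule: schwarzian_aux.induct)
     (auto intro!: meromorphic_intros meromorphic_on_pre_schwarzian)

lemma meromorphic_on_gen_schwarzian:
  "f meromorphic_on A \<Longrightarrow> gen_schwarzian k f meromorphic_on A"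
  unfolding gen_schwarzian_def by (rule meromorphic_on_schwarzian_aux)

end

theory Submission
  imports Defs
begin

text \<open>
  Put $\varphi = f''/f'$. Near a point where $\varphi$ is analytic, let $u$ be a nonvanishing solution
  of $u' = -\frac1k \varphi u$, that is, a constant multiple of a branch of $(f')^{-1/k}$. The
  quotient rule turns the recursion for $S_{m+1,k}(f)$ into
  $S_{m+1,k}(f) = -k\, u^{(m)}/u$ for $m \ge 1$, and $u^{(m)}/u$ is the $m$-th complete Bell
  polynomial in the derivatives of $\log u$. The latter holds because $a_m = u^{(m)}/(m!\,u)$
  and the sums over tuples satisfy the same recurrence $m\, a_m = \sum_{j=1}^m j\, x_j\, a_{m-j}$
  with $x_j = (\log u)^{(j)}/j!$.
\<close>

text \<open>The length K and the weight m are kept separate: \<open>weighted_tuples k\<close> is the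
  case K = m = k, but the recurrence lowers the weight while the length stays fixed.\<close>

definition tuples_of_weight :: "nat \<Rightarrow> nat \<Rightarrow> (nat \<Rightarrow> nat) set"
  where "tuples_of_weight K m = {n \<in> {1..K} \<rightarrow>\<^sub>E UNIV. (\<Sum>r=1..K. r * n r) = m}"

text \<open>This is the coefficient of t^m in exp(x_1 t + ... + x_K t^K).\<close>

definition bell_sum :: "nat \<Rightarrow> (nat \<Rightarrow> 'a::field_char_0) \<Rightarrow> nat \<Rightarrow> 'a"
  where "bell_sum K x m = (\<Sum>n\<in>tuples_of_weight K m. \<Prod>j=1..K. x j ^ n j / fact (n j))"

lemma le_weight_of_mem_tuples_of_weight:
  assumes "n \<in> tuples_of_weight K m" "j \<in> {1..K}"
  shows "j * n j \<le> m"
proof -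
  have "j * n j \<le> (\<Sum>r=1..K. r * n r)"
    using assms(2) by (intro member_le_sum) auto
  thus ?thesis using assms(1) by (simp add: tuples_of_weight_def)
qed

lemma finite_tuples_of_weight [simp]: "finite (tuples_of_weight K m)"
proof (rule finite_subset)
  show "tuples_of_weight K m \<subseteq> {1..K} \<rightarrow>\<^sub>E {..m}"
  proof
    fix n assume n: "n \<in> tuples_of_weight K m"
    have "n j \<le> m" if j: "j \<in> {1..K}" for j
    proof -
      have "n j \<le> j * n j" using j by simp
      also have "\<dots> \<le> m" by (rule le_weight_of_mem_tuples_of_weight[OF n j])
      finally show ?thesis .
    qed
    thus "n \<in> {1..K} \<rightarrow>\<^sub>E {..m}" using n by (auto simp: tuples_of_weight_def PiE_iff)
  qed
qed (auto intro: finite_PiE)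

lemma bell_sum_0: "bell_sum K x 0 = 1"
proof -
  have "tuples_of_weight K 0 = {\<lambda>j\<in>{1..K}. 0}"
    by (auto simp: tuples_of_weight_def PiE_iff extensional_def fun_eq_iff)
  thus ?thesis by (simp add: bell_sum_def)
qed

lemma tuples_of_weight_upd_Suc:
  assumes "j \<in> {1..K}"
  shows "n(j := Suc (n j)) \<in> tuples_of_weight K (m + j) \<longleftrightarrow> n \<in> tuples_of_weight K m"
proof -
  have "(\<Sum>r\<in>{1..K} - {j}. r * (n(j := Suc (n j))) r) = (\<Sum>r\<in>{1..K} - {j}. r * n r)"
    by (intro sum.cong) auto
  hence "(\<Sum>r=1..K. r * (n(j := Suc (n j))) r) = (\<Sum>r=1..K. r * n r) + j"
    by (simp add: sum.remove[OF finite_atLeastAtMost assms] del: One_nat_def)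
  thus ?thesis using assms
    by (auto simp: tuples_of_weight_def PiE_iff extensional_def)
qed

text \<open>The factor n_j removes the tuples with n_j = 0. In the others n_j / n_j! = 1 / (n_j -
  1)!, so one x_j splits off and lowering n_j by one leaves a tuple of weight m - j.\<close>

lemma bell_summand_shift:
  fixes x :: "nat \<Rightarrow> 'a::field_char_0"
  assumes j: "j \<in> {1..K}" and "j \<le> m"
  shows "(\<Sum>n\<in>tuples_of_weight K m. of_nat (n j) * (\<Prod>i=1..K. x i ^ n i / fact (n i)))
    = x j * bell_sum K x (m - j)" (is "sum ?g _ = _")
proof -
  define \<sigma> where "\<sigma> n = n(j := Suc (n j))" for n :: "nat \<Rightarrow> nat"
  have im: "\<sigma> ` tuples_of_weight K (m - j) = {n \<in> tuples_of_weight K m. n j \<noteq> 0}"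
  proof (intro equalityI subsetI)
    fix n assume "n \<in> \<sigma> ` tuples_of_weight K (m - j)"
    thus "n \<in> {n \<in> tuples_of_weight K m. n j \<noteq> 0}"
      using tuples_of_weight_upd_Suc[OF j, of _ "m - j"] \<open>j \<le> m\<close> by (auto simp: \<sigma>_def)
  next
    fix n assume n: "n \<in> {n \<in> tuples_of_weight K m. n j \<noteq> 0}"
    hence "n = \<sigma> (n(j := n j - 1))" by (auto simp: \<sigma>_def)
    moreover from this have "n(j := n j - 1) \<in> tuples_of_weight K (m - j)"
      using tuples_of_weight_upd_Suc[OF j, of "n(j := n j - 1)" "m - j"] \<open>j \<le> m\<close> n
      by (auto simp: \<sigma>_def)
    ultimately show "n \<in> \<sigma> ` tuples_of_weight K (m - j)" by blast
  qed
  have inj: "inj_on \<sigma> A" for A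
    by (rule inj_on_inverseI[where g = "\<lambda>n. n(j := n j - 1)"]) (auto simp: \<sigma>_def)
  have shift: "?g (\<sigma> n) = x j * (\<Prod>i=1..K. x i ^ n i / fact (n i))" for n
  proof -
    have "(\<Prod>i\<in>{1..K} - {j}. x i ^ \<sigma> n i / fact (\<sigma> n i)) = (\<Prod>i\<in>{1..K} - {j}. x i ^ n i / fact (n i))"
      by (intro prod.cong) (auto simp: \<sigma>_def)
    moreover have "of_nat (\<sigma> n j) * (x j ^ \<sigma> n j / fact (\<sigma> n j)) = x j * (x j ^ n j / fact (n j))"
      by (simp add: \<sigma>_def field_simps del: of_nat_Suc)
    ultimately show ?thesis
      by (simp only: prod.remove[OF finite_atLeastAtMost j] flip: mult.assoc)
  qed
  have "sum ?g (tuples_of_weight K m) = sum ?g {n \<in> tuples_of_weight K m. n j \<noteq> 0}"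
    by (intro sum.mono_neutral_right) auto
  also have "\<dots> = (\<Sum>n\<in>tuples_of_weight K (m - j). ?g (\<sigma> n))"
    unfolding im[symmetric] by (simp add: sum.reindex[OF inj])
  also have "\<dots> = x j * bell_sum K x (m - j)"
    by (simp only: shift bell_sum_def sum_distrib_left)
  finally show ?thesis .
qed

text \<open>Euler's identity for weighted homogeneous polynomials: replace the factor m in each
  summand by the weight j n_j summed over j, swap the two sums and shift. The bound m \<le> K makes
  every j up to m an admissible index.\<close>

lemma bell_sum_recurrence:
  fixes x :: "nat \<Rightarrow> 'a::field_char_0"
  assumes "m \<le> K"
  shows "of_nat m * bell_sum K x m = (\<Sum>j=1..m. of_nat j * x j * bell_sum K x (m - j))"
proof -
  define p where "p n = (\<Prod>i=1..K. x i ^ n i / fact (n i))" for n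
  have weight: "m = (\<Sum>j=1..m. j * n j)" if n: "n \<in> tuples_of_weight K m" for n
  proof -
    \<comment> \<open>For j > m the bound j n_j \<le> m forces n_j = 0, so the weight may be summed
      up to m only.\<close>
    have "n j = 0" if "j \<in> {1..K} - {1..m}" for j
      using le_weight_of_mem_tuples_of_weight[OF n, of j] that by (cases "n j") auto
    hence "(\<Sum>j=1..m. j * n j) = (\<Sum>j=1..K. j * n j)"
      using assms by (intro sum.mono_neutral_left) auto
    thus ?thesis using n by (simp add: tuples_of_weight_def)
  qed
  have "of_nat m * bell_sum K x m = (\<Sum>n\<in>tuples_of_weight K m. of_nat m * p n)"
    by (simp add: bell_sum_def p_def sum_distrib_left)
  also have "\<dots> = (\<Sum>n\<in>tuples_of_weight K m. \<Sum>j=1..m. of_nat j * (of_nat (n j) * p n))"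
  proof (intro sum.cong refl)
    fix n assume "n \<in> tuples_of_weight K m"
    hence "of_nat m = (\<Sum>j=1..m. of_nat j * of_nat (n j) :: 'a)"
      by (subst weight) simp_all
    thus "of_nat m * p n = (\<Sum>j=1..m. of_nat j * (of_nat (n j) * p n))"
      by (simp add: sum_distrib_right mult.assoc)
  qed
  also have "\<dots> = (\<Sum>j=1..m. of_nat j * (\<Sum>n\<in>tuples_of_weight K m. of_nat (n j) * p n))"
    by (subst sum.swap) (simp add: sum_distrib_left)
  also have "\<dots> = (\<Sum>j=1..m. of_nat j * x j * bell_sum K x (m - j))"
    using assms by (intro sum.cong) (auto simp: p_def bell_summand_shift mult.assoc simp del: One_nat_def)
  finally show ?thesis .
qed

text \<open>Leibniz's rule applied to u' = g u expresses each derivative of u through all lower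
  ones. After division by factorials this is \<open>bell_sum_recurrence\<close>, hence the strong
  induction.\<close>

lemma higher_deriv_log_deriv:
  fixes u g :: "complex \<Rightarrow> complex"
  assumes "open S" "u holomorphic_on S" "g holomorphic_on S" "z \<in> S"
    and u': "\<And>w. w \<in> S \<Longrightarrow> deriv u w = g w * u w"
    and "m \<le> K"
  shows "(deriv ^^ m) u z = fact m * bell_sum K (\<lambda>j. (deriv ^^ (j - 1)) g z / fact j) m * u z"
  using \<open>m \<le> K\<close>
proof (induction m rule: less_induct)
  case (less m)
  define x where "x j = (deriv ^^ (j - 1)) g z / fact j" for j
  show ?case
  proof (cases m)
    case 0
    thus ?thesis by (simp add: bell_sum_0)
  next
    case (Suc l)
    have "(deriv ^^ m) u z = (deriv ^^ l) (\<lambda>w. g w * u w) z"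
      unfolding Suc funpow_Suc_right o_apply using assms
      by (intro higher_deriv_cong_ev eventually_mono[OF eventually_nhds_in_open[of S]]) auto
    also have "\<dots> = (\<Sum>i=0..l. of_nat (l choose i) * (deriv ^^ i) g z * (deriv ^^ (l - i)) u z)"
      using assms by (intro higher_deriv_mult) auto
    also have "\<dots> = (\<Sum>i=0..l. fact l * u z * (of_nat (Suc i) * x (Suc i) * bell_sum K x (l - i)))"
    proof (intro sum.cong refl)
      fix i assume "i \<in> {0..l}"
      hence "i \<le> l" by simp
      have "(deriv ^^ (l - i)) u z = fact (l - i) * bell_sum K x (l - i) * u z"
        using less.IH[of "l - i"] less.prems Suc by (simp add: x_def[abs_def])
      moreover have "(deriv ^^ i) g z = fact (Suc i) * x (Suc i)"
        by (simp add: x_def del: fact_Suc)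
      \<comment> \<open>The factorials i! and (l - i)! of the two derivatives combine with the
        binomial coefficient to l!, and (i + 1)! = (i + 1) i! leaves the weight i + 1.\<close>
      moreover have "(fact l :: complex) = of_nat (l choose i) * fact i * fact (l - i)"
        using binomial_fact[OF \<open>i \<le> l\<close>, where ?'a = complex] by simp
      ultimately show "of_nat (l choose i) * (deriv ^^ i) g z * (deriv ^^ (l - i)) u z
          = fact l * u z * (of_nat (Suc i) * x (Suc i) * bell_sum K x (l - i))"
        by (simp add: algebra_simps)
    qed
    also have "\<dots> = fact l * u z * (\<Sum>i=0..l. of_nat (Suc i) * x (Suc i) * bell_sum K x (l - i))"
      by (simp only: sum_distrib_left)
    also have "(\<Sum>i=0..l. of_nat (Suc i) * x (Suc i) * bell_sum K x (l - i))
        = (\<Sum>j=1..m. of_nat j * x j * bell_sum K x (m - j))"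
      by (rule sum.reindex_bij_witness[of _ "\<lambda>j. j - 1" Suc]) (auto simp: Suc)
    also have "\<dots> = of_nat m * bell_sum K x m"
      by (rule bell_sum_recurrence[OF less.prems, symmetric])
    finally show ?thesis
      by (simp add: Suc x_def[abs_def] algebra_simps)
  qed
qed

text \<open>With \<phi> = f''/f', the base case is \<phi> = -k u'/u. In the step, differentiating
  1/u contributes -\<phi> u^(m+1)/u, which the correction term of the recursion cancels.\<close>

lemma schwarzian_aux_eq_higher_deriv:
  fixes u :: "complex \<Rightarrow> complex"
  assumes S: "open S" "u holomorphic_on S" and nz: "\<And>w. w \<in> S \<Longrightarrow> u w \<noteq> 0"
    and u': "\<And>w. w \<in> S \<Longrightarrow> deriv u w = - pre_schwarzian f w / of_nat k * u w"
    and "k \<ge> 1" and "z \<in> S"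
  shows "schwarzian_aux (Suc (Suc m)) k f z = - of_nat k * (deriv ^^ Suc m) u z / u z"
  using \<open>z \<in> S\<close>
proof (induction m arbitrary: z)
  case 0
  thus ?case using u'[of z] nz[of z] \<open>k \<ge> 1\<close> by simp
next
  case (Suc m)
  let ?d = "(deriv ^^ Suc m) u"
  have "?d holomorphic_on S" using S by (intro holomorphic_higher_deriv)
  hence 1: "(?d has_field_derivative deriv ?d z) (at z)"
    using S Suc.prems holomorphic_derivI by blast
  have 2: "(u has_field_derivative deriv u z) (at z)"
    using S Suc.prems holomorphic_derivI by blast
  \<comment> \<open>Differentiating the induction hypothesis requires it on a neighbourhood of z,
    which is why z is arbitrary in the induction.\<close>
  have "deriv (schwarzian_aux (Suc (Suc m)) k f) z = deriv (\<lambda>w. - of_nat k * ?d w / u w) z"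
    using S Suc by (intro deriv_cong_ev eventually_mono[OF eventually_nhds_in_open[of S]]) auto
  also have "\<dots> = - of_nat k * (deriv ?d z * u z - ?d z * deriv u z) / (u z * u z)"
    using nz[OF Suc.prems]
    by (intro DERIV_imp_deriv DERIV_divide[OF DERIV_cmult[OF 1] 2, THEN DERIV_cong])
       (simp_all add: algebra_simps del: funpow.simps)
  finally have "schwarzian_aux (Suc (Suc (Suc m))) k f z
      = - of_nat k * (deriv ?d z * u z - ?d z * deriv u z) / (u z * u z)
        - 1 / of_nat k * pre_schwarzian f z * (- of_nat k * ?d z / u z)"
    by (simp add: Suc.IH[OF Suc.prems] del: funpow.simps)
  also have "\<dots> = - of_nat k * deriv ?d z / u z"
    using nz[OF Suc.prems] \<open>k \<ge> 1\<close> unfolding u'[OF Suc.prems]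
    by (simp add: field_simps del: funpow.simps)
  finally show ?case by simp
qed

text \<open>The recursion sees f only through \<phi> = f''/f', so a disc on which \<phi> is
  holomorphic suffices to construct u.\<close>

lemma gen_schwarzian_eq_at_analytic:
  assumes an: "pre_schwarzian f analytic_on {z}" and "k \<ge> 1"
  shows "gen_schwarzian k f z = - of_nat k * fact k
    * bell_sum k (\<lambda>j. - (deriv ^^ (j - 1)) (pre_schwarzian f) z / (of_nat k * fact j)) k"
proof -
  define \<phi> where "\<phi> = pre_schwarzian f"
  from an obtain r where r: "r > 0" "\<phi> holomorphic_on ball z r"
    by (auto simp: analytic_at_ball \<phi>_def)
  \<comment> \<open>The prescribed logarithmic derivative of u. It has a primitive L because the
    disc is convex, and u = exp L is then zero-free with u' = g u.\<close>
  define g where "g = (\<lambda>w. - (1 / of_nat k) * \<phi> w)"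
  have g: "g holomorphic_on ball z r"
    unfolding g_def by (intro holomorphic_intros r)
  obtain L where L: "\<And>w. w \<in> ball z r \<Longrightarrow> (L has_field_derivative g w) (at w)"
    using holomorphic_convex_primitive'[OF convex_ball open_ball g]
    by (metis at_within_open open_ball)
  define u where "u = (\<lambda>w. exp (L w))"
  have du: "(u has_field_derivative g w * u w) (at w)" if "w \<in> ball z r" for w
    unfolding u_def by (rule derivative_eq_intros L that)+ simp
  have u: "u holomorphic_on ball z r"
    using du by (blast intro: iffD2[OF holomorphic_on_open[OF open_ball]])
  have u': "deriv u w = g w * u w" if "w \<in> ball z r" for w
    using du[OF that] by (rule DERIV_imp_deriv)
  have dg: "(deriv ^^ i) g z = - (1 / of_nat k) * (deriv ^^ i) \<phi> z" for i
    unfolding g_def using r by (intro higher_deriv_cmult[of _ "ball z r"]) auto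
  \<comment> \<open>The order k corresponds to \<open>schwarzian_aux (Suc k)\<close>, hence to the
    k-th derivative of u; k = l + 1 matches the indexing of
    \<open>schwarzian_aux_eq_higher_deriv\<close>.\<close>
  obtain l where l: "k = Suc l" using \<open>k \<ge> 1\<close> by (cases k) auto
  have "gen_schwarzian k f z = - of_nat k * (deriv ^^ k) u z / u z"
    unfolding gen_schwarzian_def using schwarzian_aux_eq_higher_deriv[of "ball z r" u f k z l] u u' r \<open>k \<ge> 1\<close>
    by (simp add: l g_def \<phi>_def u_def del: schwarzian_aux.simps funpow.simps)
  also have "(deriv ^^ k) u z = fact k * bell_sum k (\<lambda>j. (deriv ^^ (j - 1)) g z / fact j) k * u z"
    using r u u' g by (intro higher_deriv_log_deriv[of "ball z r"]) auto
  finally show ?thesis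
    by (simp add: dg \<phi>_def u_def)
qed

theorem lemma1p3:
  fixes f :: "complex \<Rightarrow> complex" and k :: nat
  assumes "f meromorphic_on ball 0 1"
    and "\<not> mero_constant_on f (ball 0 1)"
    and "k \<ge> 1"
  shows "mero_eq_on (ball 0 1) (gen_schwarzian k f)
    (\<lambda>z. \<Sum>n\<in>weighted_tuples k.
       (- of_nat k * fact k) / (\<Prod>j=1..k. (- of_nat k * fact j) ^ n j * fact (n j))
       * (\<Prod>j=1..k. ((deriv ^^ (j - 1)) (pre_schwarzian f) z) ^ n j))"
  unfolding mero_eq_on_def
\<comment> \<open>The exceptional sparse set is where f''/f' fails to be analytic; elsewhere the
  identity holds pointwise.\<close>
proof (rule eventually_mono)
  show "\<forall>\<^sub>\<approx>z\<in>ball 0 1. pre_schwarzian f analytic_on {z}"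
    by (intro meromorphic_on_imp_analytic_cosparse meromorphic_on_pre_schwarzian assms)
next
  fix z assume z: "pre_schwarzian f analytic_on {z}"
  define x where "x j = (deriv ^^ (j - 1)) (pre_schwarzian f) z" for j
  have "(\<Prod>j=1..k. (- x j / (of_nat k * fact j)) ^ n j / fact (n j))
      = (\<Prod>j=1..k. x j ^ n j) / (\<Prod>j=1..k. (- of_nat k * fact j) ^ n j * fact (n j))" for n
  proof -
    \<comment> \<open>Moving the sign into the denominator produces the factors (-k j!)^(n_j) of the
      stated formula.\<close>
    have "- x j / (of_nat k * fact j) = x j / (- of_nat k * fact j)" for j
      by simp
    thus ?thesis
      by (simp only: power_divide divide_divide_eq_left flip: prod_dividef)
  qed
  thus "gen_schwarzian k f z = (\<Sum>n\<in>weighted_tuples k.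
       (- of_nat k * fact k) / (\<Prod>j=1..k. (- of_nat k * fact j) ^ n j * fact (n j))
       * (\<Prod>j=1..k. ((deriv ^^ (j - 1)) (pre_schwarzian f) z) ^ n j))"
    unfolding gen_schwarzian_eq_at_analytic[OF z \<open>k \<ge> 1\<close>]
    by (simp add: bell_sum_def tuples_of_weight_def weighted_tuples_def sum_distrib_left
          flip: x_def del: One_nat_def)
qed

end
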